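(* Let $n$ be a positive integer and let $\mathcal{C}$ be the class of binary matroids with at most $n$ elements. There is an order-independent randomized online matroid morphism from $\mathcal{C}$ into the complete binary matroid $\mathbb{F}_2^n$.
   Context: All matroids have finite ground sets; a matroid and its ground set are denoted by the same letter. A (matroid) morphism $f:\mathbf{M}\to\mathbf{N}$ is a map between ground sets with $\mathrm{rank}_{\mathbf{N}}(f(S))=\mathrm{rank}_{\mathbf{M}}(S)$ for all $S\subseteq\mathbf{M}$. The complete binary matroid $\mathbb{F}_2^n$ has ground set all vectors of $\mathbb{F}_2^n$ (including $0$), independent sets being the linearly independent sets. A matroid is binary if it admits a morphism into $\mathbb{F}_2^d$ for some $d$. An ordering of $\mathbf{M}$ with $|\mathbf{M}|=m$ is a bijection $\pi:[m]\to\mathbf{M}$; for $m'<m$ the prefix-restriction $(\mathbf{M}',\pi')$ is the restriction of $\mathbf{M}$ to $\pi([m'])$ with $\pi'=\pi|_{[m']}$. A randomized online matroid morphism for a restriction-closed class $\mathcal{C}$ into $\mathbf{BigM}$ assigns to each $\mathbf{M}\in\mathcal{C}$ and each ordering $\pi$ a probability distribution over morphisms $f_{\mathbf{M},\pi}:\mathbf{M}\to\mathbf{BigM}$ such that for every prefix-restriction $(\mathbf{M}',\pi')$ of $(\mathbf{M},\pi)$, the restriction of $f_{\mathbf{M},\pi}$ to $\mathbf{M}'$ has the same distribution as $f_{\mathbf{M}',\pi'}$. It is order-independent if for every $\mathbf{M}$ and any two orderings $\pi,\pi'$, $f_{\mathbf{M},\pi}$ and $f_{\mathbf{M},\pi'}$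 have the same distribution. *)

theory Defs
  imports
    "HOL-Probability.Probability_Mass_Function"
    "HOL-Library.Z2"
    "Jordan_Normal_Form.VS_Connect"
begin

datatype 'a pre_matroid = Matroid (ground: "'a set") (indeps: "'a set set")

definition matroid :: "'a pre_matroid \<Rightarrow> bool" where
  "matroid M \<longleftrightarrow>
     finite (ground M) \<and>
     indeps M \<subseteq> Pow (ground M) \<and>
     {} \<in> indeps M \<and>
     (\<forall>I\<in>indeps M. \<forall>J. J \<subseteq> I \<longrightarrow> J \<in> indeps M) \<and>
     (\<forall>I\<in>indeps M. \<forall>J\<in>indeps M. card I < card J \<longrightarrow>
        (\<exists>x\<in>J - I. insert x I \<in> indeps M))"

definition matroid_rank :: "'a pre_matroid \<Rightarrow> 'a set \<Rightarrow> nat" where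
  "matroid_rank M S = Max (card ` {I \<in> indeps M. I \<subseteq> S})"

definition restrict_matroid :: "'a pre_matroid \<Rightarrow> 'a set \<Rightarrow> 'a pre_matroid" where
  "restrict_matroid M X = Matroid X {I \<in> indeps M. I \<subseteq> X}"

text \<open>Maps between ground sets are extensional functions, so that two morphisms are equal
  as HOL functions iff they agree on the ground set of the source.\<close>

definition matroid_morphism :: "'a pre_matroid \<Rightarrow> 'b pre_matroid \<Rightarrow> ('a \<Rightarrow> 'b) \<Rightarrow> bool" where
  "matroid_morphism M N f \<longleftrightarrow>
     matroid M \<and> matroid N \<and>
     f \<in> ground M \<rightarrow>\<^sub>E ground N \<and>
     (\<forall>S\<subseteq>ground M. matroid_rank N (f ` S) = matroid_rank M S)"

definition complete_binary_matroid :: "nat \<Rightarrow> bit Matrix.vec pre_matroid" where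
  "complete_binary_matroid d =
     Matroid (carrier_vec d)
       {I. I \<subseteq> carrier_vec d \<and> \<not> module.lin_dep class_ring (module_vec TYPE(bit) d) I}"

definition binary_matroid :: "'a pre_matroid \<Rightarrow> bool" where
  "binary_matroid M \<longleftrightarrow> (\<exists>d f. matroid_morphism M (complete_binary_matroid d) f)"

definition binary_matroids_upto :: "nat \<Rightarrow> 'a pre_matroid set" where
  "binary_matroids_upto n = {M. binary_matroid M \<and> card (ground M) \<le> n}"

text \<open>The index set \<open>[m]\<close> is \<open>{1..m}\<close>. Orderings are extensional for the same reason as
  morphisms.\<close>

definition matroid_ordering :: "'a pre_matroid \<Rightarrow> (nat \<Rightarrow> 'a) \<Rightarrow> bool" where
  "matroid_ordering M \<pi> \<longleftrightarrow>
     bij_betw \<pi> {1..card (ground M)} (ground M) \<and> \<pi> \<in> extensional {1..card (ground M)}"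

definition restriction_closed :: "'a pre_matroid set \<Rightarrow> bool" where
  "restriction_closed C \<longleftrightarrow> (\<forall>M\<in>C. \<forall>X\<subseteq>ground M. restrict_matroid M X \<in> C)"

text \<open>\<open>F M \<pi>\<close> is the distribution of the random morphism for \<open>M\<close> presented in the order \<open>\<pi>\<close>;
  its values at arguments other than a member of \<open>C\<close> with an ordering of it are irrelevant.\<close>

definition randomized_online_morphism ::
    "'a pre_matroid set \<Rightarrow> 'b pre_matroid \<Rightarrow>
     ('a pre_matroid \<Rightarrow> (nat \<Rightarrow> 'a) \<Rightarrow> ('a \<Rightarrow> 'b) pmf) \<Rightarrow> bool" where
  "randomized_online_morphism C N F \<longleftrightarrow>
     restriction_closed C \<and>
     (\<forall>M\<in>C. \<forall>\<pi>. matroid_ordering M \<pi> \<longrightarrow>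
        set_pmf (F M \<pi>) \<subseteq> {f. matroid_morphism M N f} \<and>
        (\<forall>m' < card (ground M).
           map_pmf (\<lambda>f. restrict f (\<pi> ` {1..m'})) (F M \<pi>) =
           F (restrict_matroid M (\<pi> ` {1..m'})) (restrict \<pi> {1..m'})))"

definition order_independent ::
    "'a pre_matroid set \<Rightarrow>
     ('a pre_matroid \<Rightarrow> (nat \<Rightarrow> 'a) \<Rightarrow> ('a \<Rightarrow> 'b) pmf) \<Rightarrow> bool" where
  "order_independent C F \<longleftrightarrow>
     (\<forall>M\<in>C. \<forall>\<pi> \<pi>'. matroid_ordering M \<pi> \<longrightarrow> matroid_ordering M \<pi>' \<longrightarrow> F M \<pi> = F M \<pi>')"

lemma finite_carrier_vec_bit: "finite (carrier_vec d :: bit Matrix.vec set)"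
proof -
  have "finite (UNIV :: bit set)"
    by (rule finite_subset[of _ "{0, 1}"]) (auto intro: bit.exhaust)
  hence "finite ({xs :: bit list. set xs \<subseteq> UNIV \<and> length xs = d})"
    by (rule finite_lists_length_eq)
  hence "finite (vec_of_list ` {xs :: bit list. set xs \<subseteq> UNIV \<and> length xs = d})"
    by simp
  moreover have "(carrier_vec d :: bit Matrix.vec set) \<subseteq>
      vec_of_list ` {xs :: bit list. set xs \<subseteq> UNIV \<and> length xs = d}"
  proof
    fix v :: "bit Matrix.vec" assume "v \<in> carrier_vec d"
    hence "length (list_of_vec v) = d" by auto
    moreover have "v = vec_of_list (list_of_vec v)" by (simp add: vec_list)
    ultimately show "v \<in> vec_of_list ` {xs :: bit list. set xs \<subseteq> UNIV \<and> length xs = d}"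
      by blast
  qed
  ultimately show ?thesis by (rule rev_finite_subset)
qed

lemma matroid_complete_binary_matroid: "matroid (complete_binary_matroid d)"
proof -
  interpret V: vec_space "TYPE(bit)" d .
  have exchange: "\<exists>x\<in>J - I. V.lin_indpt (insert x I)"
    if I: "I \<subseteq> carrier_vec d" "V.lin_indpt I" and J: "J \<subseteq> carrier_vec d" "V.lin_indpt J"
      and less: "card I < card J" for I J
  proof (rule ccontr)
    assume neg: "\<not> ?thesis"
    have fin: "finite I" "finite J"
      using I J finite_carrier_vec_bit finite_subset by blast+
    have "J \<subseteq> V.span I"
    proof
      fix x assume x: "x \<in> J"
      show "x \<in> V.span I"
      proof (cases "x \<in> I")
        case True
        thus ?thesis using V.in_own_span[OF I(1)] by blast
      next
        case False
        hence "V.lin_dep (I \<union> {x})" using neg x by auto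
        thus ?thesis using V.lin_dep_iff_in_span[of I x] I J x False by auto
      qed
    qed
    from V.replacement[OF fin(2) fin(1) I(1) J(2) this]
    have "\<exists>C :: bit Matrix.vec set. int (card C) \<le> int (card I) - int (card J)" by (elim exE conjE) (rule exI)
    then obtain C :: "bit Matrix.vec set" where "int (card C) \<le> int (card I) - int (card J)" ..
    thus False using less by linarith
  qed
  have empty: "V.lin_indpt {}" unfolding V.lin_dep_def by blast
  show ?thesis
    unfolding matroid_def complete_binary_matroid_def
  proof (simp only: pre_matroid.sel, intro conjI ballI allI impI)
    show "finite (carrier_vec d :: bit Matrix.vec set)" by (rule finite_carrier_vec_bit)
  next
    fix I J assume "I \<in> {I. I \<subseteq> carrier_vec d \<and> V.lin_indpt I}" "J \<subseteq> I"
    thus "J \<in> {I. I \<subseteq> carrier_vec d \<and> V.lin_indpt I}"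
      using V.subset_li_is_li[of I J] by blast
  next
    fix I J assume "I \<in> {I. I \<subseteq> carrier_vec d \<and> V.lin_indpt I}"
      "J \<in> {I. I \<subseteq> carrier_vec d \<and> V.lin_indpt I}" "card I < card J"
    thus "\<exists>x\<in>J - I. insert x I \<in> {I. I \<subseteq> carrier_vec d \<and> V.lin_indpt I}"
      using exchange[of I J] by blast
  qed (use empty in blast)+
qed

end

theory Submission
  imports Defs "HOL-Library.Function_Algebras"
begin

text \<open>The random morphism is uniform over all morphisms. Any two binary representations of a
  matroid have the same subsets with zero sum, namely the disjoint unions of circuits. Hence the
  number of ways to extend a morphism by one further element \<open>e\<close> does not depend on the morphism:
  it is one if \<open>e\<close> lies in the closure of the earlier elements, and otherwise the number of vectors
  outside the span of their image. Therefore the uniform distribution restricts to the uniform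
  distribution. A morphism exists because fewer than \<open>n\<close> vectors cannot span \<open>n\<close> dimensions.\<close>

text \<open>Padding with zeros places the vectors of all dimensions in one additive group, so that
  representations in different dimensions can be compared.\<close>
definition coords :: "bit Matrix.vec \<Rightarrow> nat \<Rightarrow> bit" where
  "coords v = (\<lambda>i. if i < dim_vec v then v $ i else 0)"

definition vsum :: "('a \<Rightarrow> bit Matrix.vec) \<Rightarrow> 'a set \<Rightarrow> nat \<Rightarrow> bit" where
  "vsum f A = (\<Sum>a\<in>A. coords (f a))"

text \<open>Over the two-element field a linear combination is a subset sum, so no coefficients
  appear. Independence belongs to the family, not to its image: two indices with the same vector
  form a zero sum.\<close>

definition independent_family :: "('a \<Rightarrow> bit Matrix.vec) \<Rightarrow> 'a set \<Rightarrow> bool" where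
  "independent_family f S \<longleftrightarrow> (\<forall>A\<subseteq>S. A \<noteq> {} \<longrightarrow> vsum f A \<noteq> 0)"

text \<open>Maps with the same linear relations as the reference representation \<open>r\<close>, which may live
  in another dimension.\<close>
definition relmaps :: "nat \<Rightarrow> ('a \<Rightarrow> bit Matrix.vec) \<Rightarrow> 'a set \<Rightarrow> ('a \<Rightarrow> bit Matrix.vec) set" where
  "relmaps n r X = {f \<in> X \<rightarrow>\<^sub>E carrier_vec n. \<forall>A\<subseteq>X. vsum f A = 0 \<longleftrightarrow> vsum r A = 0}"

section \<open>Subset sums over the two-element field\<close>

lemma bit_fun_add_self: "x + x = (0 :: nat \<Rightarrow> bit)"
  by (rule ext) (simp add: plus_fun_def zero_fun_def)

lemma bit_fun_add_eq_0_iff: "x + y = (0 :: nat \<Rightarrow> bit) \<longleftrightarrow> x = y"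
  by (metis add_left_cancel bit_fun_add_self)

text \<open>The dimension has to be fixed, since padding identifies vectors that differ only by
  trailing zeros.\<close>

lemma coords_inj: "inj_on coords (carrier_vec n)"
proof (rule inj_onI, rule eq_vecI)
  fix v w :: "bit Matrix.vec" and i
  assume vw: "v \<in> carrier_vec n" "w \<in> carrier_vec n" "coords v = coords w"
  then show "dim_vec v = dim_vec w" by simp
  assume "i < dim_vec w"
  then show "v $ i = w $ i" using fun_cong[OF vw(3), of i] vw(1,2) by (simp add: coords_def)
qed

lemma vsum_apply: "vsum f A i = (\<Sum>a\<in>A. coords (f a) i)"
  unfolding vsum_def by (induction A rule: infinite_finite_induct) (auto simp: zero_fun_def plus_fun_def)

text \<open>The span of an image, formed in the common group of padded vectors, can thus be counted
  inside the space of dimension \<open>n\<close>.\<close>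

lemma vsum_in_range:
  assumes "f \<in> A \<rightarrow> carrier_vec n"
  shows "vsum f A \<in> coords ` carrier_vec n"
proof
  show "vsum f A = coords (Matrix.vec n (vsum f A))"
  proof (rule ext)
    fix i
    have "vsum f A i = 0" if "\<not> i < n"
      unfolding vsum_apply using assms that
      by (intro sum.neutral) (auto simp: coords_def dest!: carrier_vecD funcset_mem)
    then show "vsum f A i = coords (Matrix.vec n (vsum f A)) i"
      by (auto simp: coords_def)
  qed
qed simp

lemma vsum_empty [simp]: "vsum f {} = 0"
  by (simp add: vsum_def)

lemma vsum_insert: "finite A \<Longrightarrow> e \<notin> A \<Longrightarrow> vsum f (insert e A) = coords (f e) + vsum f A"
  by (simp add: vsum_def)

lemma vsum_cong: "(\<And>a. a \<in> A \<Longrightarrow> f a = g a) \<Longrightarrow> vsum f A = vsum g A"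
  by (simp add: vsum_def)

text \<open>Elements of the intersection are counted twice and cancel in characteristic two.\<close>

lemma vsum_sym_diff:
  assumes "finite A" "finite B"
  shows "vsum f (sym_diff A B) = vsum f A + vsum f B"
proof -
  have "vsum f A = vsum f (A - B) + vsum f (A \<inter> B)"
    unfolding vsum_def using sum.Int_Diff[OF assms(1), of _ B] by (simp add: add.commute)
  moreover have "vsum f B = vsum f (B - A) + vsum f (A \<inter> B)"
    unfolding vsum_def using sum.Int_Diff[OF assms(2), of _ A] by (simp add: add.commute Int_commute)
  moreover have "vsum f (sym_diff A B) = vsum f (A - B) + vsum f (B - A)"
    unfolding vsum_def by (rule sum.union_disjoint) (use assms in auto)
  moreover have "(x + z) + (y + z) = x + y" for x y z :: "nat \<Rightarrow> bit"
  proof -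
    have "(x + z) + (y + z) = (x + y) + (z + z)" by (simp only: ac_simps)
    then show ?thesis by (simp only: bit_fun_add_self add_0_right)
  qed
  ultimately show ?thesis by simp
qed

text \<open>Zero sums alone thus decide every coincidence between subset sums, which is why
  \<open>relmaps\<close> records nothing else.\<close>

lemma vsum_eq_iff:
  assumes "finite A" "finite B"
  shows "vsum f A = vsum f B \<longleftrightarrow> vsum f (sym_diff A B) = 0"
  using assms by (simp add: vsum_sym_diff bit_fun_add_eq_0_iff)

text \<open>A minimal dependent subset (circuit) of \<open>A\<close> is a zero sum of both families; peeling it off
  reduces \<open>A\<close>.\<close>
lemma zero_sums_determined:
  assumes "finite X" and same: "\<And>S. S \<subseteq> X \<Longrightarrow> independent_family f S \<longleftrightarrow> independent_family g S"
    and "A \<subseteq> X" "vsum f A = 0"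
  shows "vsum g A = 0"
  using assms(3,4)
proof (induction "card A" arbitrary: A rule: less_induct)
  case less
  show ?case
  proof (cases "A = {}")
    case False
    have finA: "finite A" using less.prems assms(1) finite_subset by blast
    \<comment> \<open>A minimal member of this family is a circuit of \<open>f\<close>. Both
      families have the same independent subsets, so it is also a circuit of
      \<open>g\<close>.\<close>
    define \<D> where "\<D> = {C. C \<subseteq> A \<and> \<not> independent_family f C}"
    have "A \<in> \<D>" using less.prems False by (auto simp: \<D>_def independent_family_def)
    moreover have "finite \<D>" unfolding \<D>_def using finA by simp
    ultimately obtain C where C: "C \<in> \<D>" and min: "\<And>D. D \<in> \<D> \<Longrightarrow> D \<subseteq> C \<Longrightarrow> D = C"
      using finite_has_minimal[of \<D>] by blast
    have CA: "C \<subseteq> A" and depf: "\<not> independent_family f C" using C by (auto simp: \<D>_def)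
    have depg: "\<not> independent_family g C" using depf same[of C] CA less.prems by auto
    obtain D where D: "D \<subseteq> C" "D \<noteq> {}" "vsum f D = 0"
      using depf by (auto simp: independent_family_def)
    \<comment> \<open>The nonempty zero-sum set \<open>D\<close> is itself dependent, so minimality
      of \<open>C\<close> forces \<open>D = C\<close>.\<close>
    have "D \<in> \<D>" using D CA by (auto simp: \<D>_def independent_family_def)
    then have f0: "vsum f C = 0" using min D by blast
    obtain E where E: "E \<subseteq> C" "E \<noteq> {}" "vsum g E = 0"
      using depg by (auto simp: independent_family_def)
    \<comment> \<open>A subset dependent for \<open>g\<close> is dependent for \<open>f\<close>, so
      minimality, stated for \<open>f\<close>, applies to \<open>E\<close> as well.\<close>
    have "\<not> independent_family g E" using E by (auto simp: independent_family_def)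
    then have "E \<in> \<D>" using E CA same[of E] less.prems by (auto simp: \<D>_def)
    then have g0: "vsum g C = 0" using min E by blast
    have split: "vsum h A = vsum h (A - C) + vsum h C" for h :: "_ \<Rightarrow> bit Matrix.vec"
      unfolding vsum_def using sum.subset_diff[OF CA finA] by blast
    have "card (A - C) < card A"
      using D CA finA by (intro psubset_card_mono) auto
    moreover have "vsum f (A - C) = 0" using split[of f] f0 less.prems by simp
    ultimately have "vsum g (A - C) = 0" using less.hyps[of "A - C"] less.prems by auto
    then show ?thesis using split[of g] g0 by simp
  qed simp
qed

section \<open>Linear independence as absence of zero sums\<close>

lemma independent_family_iff:
  assumes fin: "finite S" and f: "f \<in> S \<rightarrow> carrier_vec d"
  shows "independent_family f S \<longleftrightarrow>
    inj_on f S \<and> \<not> module.lin_dep class_ring (module_vec TYPE(bit) d) (f ` S)"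
proof -
  interpret V: vec_space "TYPE(bit)" d .
  have crd: "coords (f s) i = (if i < d then f s $ i else 0)" if "s \<in> S" for s i
    using f that by (auto simp: coords_def dest!: carrier_vecD funcset_mem)
  have indep_to_inj: "inj_on f S" if ind: "independent_family f S"
  proof (rule inj_onI, rule ccontr)
    fix x y assume xy: "x \<in> S" "y \<in> S" "f x = f y" "x \<noteq> y"
    have "vsum f {x, y} = 0" using xy by (simp add: vsum_def bit_fun_add_self)
    then show False using ind xy by (auto simp: independent_family_def)
  qed
  have "V.lin_indpt (f ` S)" if ind: "independent_family f S"
  proof
    assume "V.lin_dep (f ` S)"
    then obtain B a v where B: "finite B" "B \<subseteq> f ` S" "V.lincomb a B = 0\<^sub>v d" "v \<in> B" "a v \<noteq> 0"
      unfolding V.lin_dep_def by (auto simp: module_vec_simps class_ring_simps)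
    \<comment> \<open>Nonzero coefficients are 1, so the combination is the sum over its support;
      \<open>A\<close> is that support pulled back to the indices.\<close>
    define A where "A = {s \<in> S. f s \<in> B \<and> a (f s) \<noteq> 0}"
    have inj: "inj_on f A" using indep_to_inj[OF ind] by (rule inj_on_subset) (auto simp: A_def)
    have img: "f ` A = {v \<in> B. a v \<noteq> 0}" using B(2) by (auto simp: A_def)
    have Bc: "B \<subseteq> carrier_vec d" using B(2) f by auto
    have "vsum f A i = 0" for i
    proof (cases "i < d")
      case True
      have "vsum f A i = (\<Sum>s\<in>A. f s $ i)"
        unfolding vsum_apply by (rule sum.cong) (use True crd in \<open>auto simp: A_def\<close>)
      also have "\<dots> = (\<Sum>v\<in>f ` A. v $ i)" using inj by (simp add: sum.reindex)
      also have "\<dots> = (\<Sum>v\<in>B. a v * v $ i)"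
        unfolding img by (rule sum.mono_neutral_cong_left) (use B(1) in auto)
      also have "\<dots> = 0" using V.lincomb_index[OF True Bc, of a] B(3) True by simp
      finally show ?thesis .
    next
      case False
      show ?thesis unfolding vsum_apply
        by (rule sum.neutral) (use False crd in \<open>auto simp: A_def\<close>)
    qed
    then have "vsum f A = 0" by (auto simp: zero_fun_def)
    moreover have "A \<noteq> {}" "A \<subseteq> S" using img B(4,5) by (auto simp: A_def)
    ultimately show False using ind by (auto simp: independent_family_def)
  qed
  moreover have "independent_family f S" if inj: "inj_on f S" and ind: "V.lin_indpt (f ` S)"
    unfolding independent_family_def
  proof (intro allI impI notI)
    fix A assume A: "A \<subseteq> S" "A \<noteq> {}" "vsum f A = 0"
    have injA: "inj_on f A" using inj A(1) by (rule inj_on_subset)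
    have Ac: "f ` A \<subseteq> carrier_vec d" using f A(1) by auto
    have finA: "finite (f ` A)" using A(1) fin finite_subset by blast
    \<comment> \<open>All coefficients are 1; injectivity makes the sum over the image of
      \<open>A\<close> agree with the sum over the indices.\<close>
    have "V.lincomb (\<lambda>_. 1) (f ` A) = 0\<^sub>v d"
    proof (rule eq_vecI)
      fix i assume "i < dim_vec (0\<^sub>v d :: bit Matrix.vec)"
      then have i: "i < d" by simp
      have "V.lincomb (\<lambda>_. 1) (f ` A) $ i = (\<Sum>s\<in>A. f s $ i)"
        unfolding V.lincomb_index[OF i Ac] sum.reindex[OF injA] by (simp only: mult_1 o_def)
      also have "\<dots> = vsum f A i"
        unfolding vsum_apply by (rule sum.cong) (use i crd A(1) in auto)
      finally show "V.lincomb (\<lambda>_. 1) (f ` A) $ i = 0\<^sub>v d $ i" using A(3) i by simp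
    qed (use V.lincomb_dim[OF finA Ac] in simp)
    moreover obtain x where "x \<in> A" using A(2) by blast
    ultimately have "V.lin_dep (f ` S)"
      unfolding V.lin_dep_def using finA A(1)
      by (intro exI[of _ "f ` A"] exI[of _ "\<lambda>_. 1"] exI[of _ "f x"])
        (auto simp: module_vec_simps class_ring_simps)
    then show False using ind by blast
  qed
  ultimately show ?thesis using indep_to_inj by blast
qed

section \<open>Matroid rank and morphisms\<close>

lemma matroid_rank_eq_card_iff:
  assumes "matroid M" "S \<subseteq> ground M"
  shows "matroid_rank M S = card S \<longleftrightarrow> S \<in> indeps M"
proof -
  have fin: "finite S" using assms finite_subset by (auto simp: matroid_def)
  have finI: "finite {I \<in> indeps M. I \<subseteq> S}" using fin by simp
  have ne: "{I \<in> indeps M. I \<subseteq> S} \<noteq> {}" using assms(1) by (auto simp: matroid_def)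
  show ?thesis
  proof
    assume "matroid_rank M S = card S"
    then have "card S \<in> card ` {I \<in> indeps M. I \<subseteq> S}"
      using Max_in[OF finite_imageI[OF finI], of card] ne by (simp add: matroid_rank_def)
    then obtain I where "I \<in> indeps M" "I \<subseteq> S" "card I = card S" by auto
    then show "S \<in> indeps M" using card_subset_eq[OF fin] by blast
  next
    assume "S \<in> indeps M"
    then have "card S \<in> card ` {I \<in> indeps M. I \<subseteq> S}" by blast
    moreover have "k \<le> card S" if "k \<in> card ` {I \<in> indeps M. I \<subseteq> S}" for k
      using that card_mono[OF fin] by blast
    ultimately show "matroid_rank M S = card S"
      unfolding matroid_rank_def using finI by (intro Max_eqI) auto
  qed
qed

lemma matroid_rank_le_card:
  assumes "matroid M" "finite S"
  shows "matroid_rank M S \<le> card S"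
proof -
  have "{I \<in> indeps M. I \<subseteq> S} \<noteq> {}" using assms by (auto simp: matroid_def)
  then show ?thesis unfolding matroid_rank_def using assms(2)
    by (subst Max_le_iff) (auto intro: card_mono)
qed

lemma matroid_rank_attained:
  assumes "matroid M" "finite S"
  obtains I where "I \<in> indeps M" "I \<subseteq> S" "card I = matroid_rank M S"
proof -
  have "{I \<in> indeps M. I \<subseteq> S} \<noteq> {}" using assms by (auto simp: matroid_def)
  then have "matroid_rank M S \<in> card ` {I \<in> indeps M. I \<subseteq> S}"
    unfolding matroid_rank_def using assms(2) by (intro Max_in) auto
  then show thesis using that by auto
qed

lemma card_le_matroid_rank:
  assumes "finite S" "I \<in> indeps M" "I \<subseteq> S"
  shows "card I \<le> matroid_rank M S"
  unfolding matroid_rank_def using assms by (intro Max_ge) auto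

text \<open>Full rank detects independence, which gives one direction. For the other, a largest
  independent subset can be transported along \<open>f\<close> in both directions without changing
  its size.\<close>

lemma matroid_morphism_iff:
  "matroid_morphism M N f \<longleftrightarrow>
     matroid M \<and> matroid N \<and> f \<in> ground M \<rightarrow>\<^sub>E ground N \<and>
     (\<forall>S\<subseteq>ground M. S \<in> indeps M \<longleftrightarrow> inj_on f S \<and> f ` S \<in> indeps N)"
proof -
  have "(\<forall>S\<subseteq>ground M. matroid_rank N (f ` S) = matroid_rank M S) \<longleftrightarrow>
     (\<forall>S\<subseteq>ground M. S \<in> indeps M \<longleftrightarrow> inj_on f S \<and> f ` S \<in> indeps N)"
    if M: "matroid M" and N: "matroid N" and f: "f \<in> ground M \<rightarrow>\<^sub>E ground N"
  proof (rule iffI; intro allI impI)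
    fix S
    assume rk: "\<forall>S\<subseteq>ground M. matroid_rank N (f ` S) = matroid_rank M S" and S: "S \<subseteq> ground M"
    have fin: "finite S" using S M finite_subset by (auto simp: matroid_def)
    have fS: "f ` S \<subseteq> ground N" using S f by auto
    have le: "matroid_rank N (f ` S) \<le> card (f ` S)" "card (f ` S) \<le> card S"
      using matroid_rank_le_card[OF N] fin card_image_le by auto
    have "S \<in> indeps M \<longleftrightarrow> matroid_rank N (f ` S) = card S"
      using matroid_rank_eq_card_iff[OF M S] rk S by simp
    \<comment> \<open>The rank is at most the size of the image, which is at most the size of
      \<open>S\<close>. Equality throughout means injectivity together with independence of the
      image.\<close>
    also have "\<dots> \<longleftrightarrow> card (f ` S) = card S \<and> matroid_rank N (f ` S) = card (f ` S)"
      using le by linarith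
    also have "\<dots> \<longleftrightarrow> inj_on f S \<and> f ` S \<in> indeps N"
      using matroid_rank_eq_card_iff[OF N fS] inj_on_iff_eq_card[OF fin, of f] by simp
    finally show "S \<in> indeps M \<longleftrightarrow> inj_on f S \<and> f ` S \<in> indeps N" .
  next
    fix S
    assume ind: "\<forall>S\<subseteq>ground M. S \<in> indeps M \<longleftrightarrow> inj_on f S \<and> f ` S \<in> indeps N"
      and S: "S \<subseteq> ground M"
    have fin: "finite S" using S M finite_subset by (auto simp: matroid_def)
    show "matroid_rank N (f ` S) = matroid_rank M S"
    proof (rule antisym)
      obtain J where J: "J \<in> indeps N" "J \<subseteq> f ` S" "card J = matroid_rank N (f ` S)"
        using matroid_rank_attained[OF N, of "f ` S"] fin by blast
      \<comment> \<open>Choosing one preimage for each element of \<open>J\<close> gives an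
        independent set of \<open>M\<close> of the same size.\<close>
      obtain I where I: "I \<subseteq> S" "inj_on f I" "J = f ` I" using J(2) by (metis subset_image_inj)
      then have "I \<in> indeps M" using ind J S by auto
      then show "matroid_rank N (f ` S) \<le> matroid_rank M S"
        using card_le_matroid_rank[OF fin _ I(1)] J I card_image by metis
    next
      obtain I where I: "I \<in> indeps M" "I \<subseteq> S" "card I = matroid_rank M S"
        using matroid_rank_attained[OF M fin] by blast
      have "inj_on f I" "f ` I \<in> indeps N" using ind I S by auto
      then show "matroid_rank M S \<le> matroid_rank N (f ` S)"
        using card_le_matroid_rank[of "f ` S" "f ` I" N] fin I card_image by (metis finite_imageI image_mono)
    qed
  qed
  then show ?thesis unfolding matroid_morphism_def by blast
qed

section \<open>Morphisms into complete binary matroids\<close>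

lemma binary_morphism_iff:
  "matroid_morphism M (complete_binary_matroid d) f \<longleftrightarrow>
     matroid M \<and> f \<in> ground M \<rightarrow>\<^sub>E carrier_vec d \<and>
     (\<forall>S\<subseteq>ground M. S \<in> indeps M \<longleftrightarrow> independent_family f S)"
proof -
  have "inj_on f S \<and> f ` S \<in> indeps (complete_binary_matroid d) \<longleftrightarrow> independent_family f S"
    if "matroid M" "f \<in> ground M \<rightarrow>\<^sub>E carrier_vec d" "S \<subseteq> ground M" for S
  proof -
    have "finite S" using that finite_subset by (auto simp: matroid_def)
    moreover have "f \<in> S \<rightarrow> carrier_vec d" using that by auto
    ultimately show ?thesis
      by (auto simp: independent_family_iff complete_binary_matroid_def)
  qed
  moreover have "ground (complete_binary_matroid d) = carrier_vec d"
    by (simp add: complete_binary_matroid_def)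
  ultimately show ?thesis
    unfolding matroid_morphism_iff using matroid_complete_binary_matroid[of d] by auto
qed

text \<open>The matroid prescribes the independent subfamilies, and these determine the zero sums
  and are determined by them. One reference representation, in whatever dimension binarity provides,
  therefore describes all morphisms into dimension \<open>n\<close>.\<close>

lemma morphisms_eq_relmaps:
  assumes r: "matroid_morphism M (complete_binary_matroid d) r"
  shows "{f. matroid_morphism M (complete_binary_matroid n) f} = relmaps n r (ground M)"
proof -
  have M: "matroid M" and fin: "finite (ground M)"
    and rind: "\<And>S. S \<subseteq> ground M \<Longrightarrow> S \<in> indeps M \<longleftrightarrow> independent_family r S"
    using r by (auto simp: binary_morphism_iff matroid_def)
  have "(\<forall>S\<subseteq>ground M. S \<in> indeps M \<longleftrightarrow> independent_family f S) \<longleftrightarrow>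
      (\<forall>A\<subseteq>ground M. vsum f A = 0 \<longleftrightarrow> vsum r A = 0)" for f :: "_ \<Rightarrow> bit Matrix.vec"
  proof
    assume "\<forall>S\<subseteq>ground M. S \<in> indeps M \<longleftrightarrow> independent_family f S"
    then have "independent_family f S \<longleftrightarrow> independent_family r S" if "S \<subseteq> ground M" for S
      using rind that by blast
    then show "\<forall>A\<subseteq>ground M. vsum f A = 0 \<longleftrightarrow> vsum r A = 0"
      using zero_sums_determined[OF fin, of f r] zero_sums_determined[OF fin, of r f] by metis
  next
    assume *: "\<forall>A\<subseteq>ground M. vsum f A = 0 \<longleftrightarrow> vsum r A = 0"
    show "\<forall>S\<subseteq>ground M. S \<in> indeps M \<longleftrightarrow> independent_family f S"
    proof (intro allI impI)
      fix S assume S: "S \<subseteq> ground M"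
      then show "S \<in> indeps M \<longleftrightarrow> independent_family f S"
        unfolding rind[OF S] independent_family_def using * by (metis order_trans)
    qed
  qed
  then show ?thesis using M by (auto simp: binary_morphism_iff relmaps_def)
qed

lemma matroid_restrict:
  assumes "matroid M" "X \<subseteq> ground M"
  shows "matroid (restrict_matroid M X)"
proof -
  have "finite X" using assms finite_subset by (auto simp: matroid_def)
  moreover have "\<exists>x\<in>J - I. insert x I \<in> indeps M \<and> insert x I \<subseteq> X"
    if IJ: "I \<in> indeps M" "I \<subseteq> X" "J \<in> indeps M" "J \<subseteq> X" "card I < card J" for I J
  proof -
    obtain x where "x \<in> J - I" "insert x I \<in> indeps M"
      using assms(1) IJ unfolding matroid_def by blast
    then show ?thesis using IJ by blast
  qed
  moreover have "{} \<in> indeps M" "\<And>I J. I \<in> indeps M \<Longrightarrow> J \<subseteq> I \<Longrightarrow> J \<in> indeps M"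
    using assms(1) unfolding matroid_def by blast+
  ultimately show ?thesis
    unfolding matroid_def restrict_matroid_def by auto
qed

lemma binary_morphism_restrict:
  assumes r: "matroid_morphism M (complete_binary_matroid d) r" and X: "X \<subseteq> ground M"
  shows "matroid_morphism (restrict_matroid M X) (complete_binary_matroid d) (restrict r X)"
proof -
  have "independent_family (restrict r X) S \<longleftrightarrow> independent_family r S" if "S \<subseteq> X" for S
  proof -
    have "vsum (restrict r X) A = vsum r A" if "A \<subseteq> S" for A
      by (rule vsum_cong) (use that \<open>S \<subseteq> X\<close> in auto)
    then show ?thesis by (simp add: independent_family_def)
  qed
  then show ?thesis
    using r X matroid_restrict[of M X] unfolding binary_morphism_iff
    by (auto simp: restrict_matroid_def)
qed

lemma relmaps_cong:
  assumes "\<And>x. x \<in> X \<Longrightarrow> r x = s x"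
  shows "relmaps n r X = relmaps n s X"
proof -
  have "vsum r A = vsum s A" if "A \<subseteq> X" for A
    by (rule vsum_cong) (use assms that in auto)
  then show ?thesis by (auto simp: relmaps_def)
qed

lemma finite_relmaps: "finite X \<Longrightarrow> finite (relmaps n r X)"
  by (rule finite_subset[of _ "X \<rightarrow>\<^sub>E carrier_vec n"])
    (auto simp: relmaps_def intro: finite_PiE finite_carrier_vec_bit)

section \<open>Counting one-element extensions\<close>

lemma card_carrier_vec_bit_ge: "2 ^ n \<le> card (carrier_vec n :: bit Matrix.vec set)"
proof -
  let ?v = "\<lambda>A. Matrix.vec n (\<lambda>i. if i \<in> A then 1 else 0 :: bit)"
  have "inj_on ?v (Pow {..<n})"
  proof (rule inj_onI)
    fix A B assume AB: "A \<in> Pow {..<n}" "B \<in> Pow {..<n}" and eq: "?v A = ?v B"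
    have "i \<in> A \<longleftrightarrow> i \<in> B" if "i < n" for i
      using arg_cong[OF eq, of "\<lambda>v. v $ i"] that by (auto split: if_splits)
    then show "A = B" using AB by auto
  qed
  then have "card (Pow {..<n}) \<le> card (carrier_vec n :: bit Matrix.vec set)"
    by (rule card_inj_on_le) (auto intro: finite_carrier_vec_bit)
  then show ?thesis by (simp add: card_Pow)
qed

text \<open>Sending \<open>f a\<close> to \<open>g a\<close> is well defined and injective, because
  both maps identify the same pairs.\<close>

lemma card_image_eq_if_same_kernel:
  assumes "\<And>a b. a \<in> S \<Longrightarrow> b \<in> S \<Longrightarrow> f a = f b \<longleftrightarrow> g a = g b"
  shows "card (f ` S) = card (g ` S)"
proof (rule bij_betw_same_card)
  have g: "g (inv_into S f (f a)) = g a" if "a \<in> S" for a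
    using assms that by (metis f_inv_into_f image_eqI inv_into_into)
  show "bij_betw (\<lambda>y. g (inv_into S f y)) (f ` S) (g ` S)"
    unfolding bij_betw_def inj_on_def
    using assms by (auto simp: g image_image)
qed

text \<open>These are the admissible values at a new element \<open>e\<close>. In characteristic
  two, a subset of \<open>X\<close> together with \<open>e\<close> sums to zero exactly when the
  vector at \<open>e\<close> equals the sum over that subset.\<close>

definition extension_values ::
    "nat \<Rightarrow> ('a \<Rightarrow> bit Matrix.vec) \<Rightarrow> 'a set \<Rightarrow> 'a \<Rightarrow> ('a \<Rightarrow> bit Matrix.vec) \<Rightarrow> bit Matrix.vec set" where
  "extension_values n r X e f =
     {v \<in> carrier_vec n. \<forall>A\<subseteq>X. coords v = vsum f A \<longleftrightarrow> coords (r e) = vsum r A}"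

text \<open>Only the reference map enters, which is what makes all fibres of restriction equally
  large. For finite \<open>X\<close> the subset sums form the span of the image: a value in the span
  is forced, and otherwise every vector outside it is allowed.\<close>

definition extension_count :: "nat \<Rightarrow> ('a \<Rightarrow> bit Matrix.vec) \<Rightarrow> 'a set \<Rightarrow> 'a \<Rightarrow> nat" where
  "extension_count n r X e =
     (if coords (r e) \<in> vsum r ` Pow X then 1
      else card (carrier_vec n :: bit Matrix.vec set) - card (vsum r ` Pow X))"

lemma relmaps_vsum_eq_iff:
  assumes "finite X" "f \<in> relmaps n r X" "A \<subseteq> X" "B \<subseteq> X"
  shows "vsum f A = vsum f B \<longleftrightarrow> vsum r A = vsum r B"
proof -
  have "finite A" "finite B" using assms finite_subset by blast+
  moreover have "sym_diff A B \<subseteq> X" using assms by auto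
  ultimately show ?thesis using assms(2) by (simp add: vsum_eq_iff relmaps_def)
qed

lemma card_extension_values:
  assumes X: "finite X" and f: "f \<in> relmaps n r X"
  shows "card (extension_values n r X e f) = extension_count n r X e"
proof -
  have fX: "f \<in> X \<rightarrow> carrier_vec n" using f by (auto simp: relmaps_def)
  have rng: "vsum f A \<in> coords ` carrier_vec n" if "A \<subseteq> X" for A
    by (rule vsum_in_range) (use fX that in auto)
  show ?thesis
  proof (cases "coords (r e) \<in> vsum r ` Pow X")
    case True
    then obtain A where A: "A \<subseteq> X" "coords (r e) = vsum r A" by auto
    obtain v where v: "v \<in> carrier_vec n" "vsum f A = coords v" using rng[OF A(1)] by auto
    \<comment> \<open>The subset \<open>A\<close> that expresses \<open>e\<close> in the reference
      map fixes \<open>v\<close>. The conditions for the other subsets follow because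
      \<open>f\<close> and \<open>r\<close> have the same coincidences of subset sums.\<close>
    have "extension_values n r X e f = {v}"
    proof (intro equalityI subsetI)
      fix w assume "w \<in> extension_values n r X e f"
      then have "w \<in> carrier_vec n" "coords w = coords v"
        using A v by (auto simp: extension_values_def)
      then show "w \<in> {v}" using inj_onD[OF coords_inj] v by blast
    next
      fix w assume "w \<in> {v}"
      then show "w \<in> extension_values n r X e f"
        using v A relmaps_vsum_eq_iff[OF X f A(1)] by (auto simp: extension_values_def simp flip: v(2))
    qed
    then show ?thesis using True by (simp add: extension_count_def)
  next
    case False
    let ?c = "carrier_vec n :: bit Matrix.vec set"
    \<comment> \<open>No subset sum of \<open>r\<close> equals the vector at \<open>e\<close>, so
      the condition reduces to avoiding every subset sum of \<open>f\<close>.\<close>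
    have "coords ` extension_values n r X e f = coords ` ?c - vsum f ` Pow X"
      using False by (auto simp: extension_values_def)
    moreover have "card (coords ` extension_values n r X e f) = card (extension_values n r X e f)"
      by (rule card_image, rule inj_on_subset[OF coords_inj[of n]]) (auto simp: extension_values_def)
    moreover have "card (coords ` ?c - vsum f ` Pow X) = card (coords ` ?c) - card (vsum f ` Pow X)"
      by (rule card_Diff_subset) (use X rng in auto)
    moreover have "card (coords ` ?c) = card ?c" by (rule card_image[OF coords_inj])
    \<comment> \<open>\<open>f\<close> and \<open>r\<close> identify the same pairs of subsets, so
      their spans have equal size even when the dimensions differ.\<close>
    moreover have "card (vsum f ` Pow X) = card (vsum r ` Pow X)"
      by (rule card_image_eq_if_same_kernel) (use relmaps_vsum_eq_iff[OF X f] in auto)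
    ultimately show ?thesis using False by (simp add: extension_count_def)
  qed
qed

text \<open>A set of size k spans at most 2^k vectors, so some vector of the larger space stays
  free. This is where the bound by \<open>n\<close> on the size of the matroid enters.\<close>

lemma extension_count_pos:
  assumes "finite X" "card X < n"
  shows "0 < extension_count n r X e"
proof -
  have "card (vsum r ` Pow X) \<le> 2 ^ card X"
    using card_image_le[of "Pow X" "vsum r"] assms(1) by (simp add: card_Pow)
  also have "\<dots> < 2 ^ n" using assms(2) by simp
  also have "\<dots> \<le> card (carrier_vec n :: bit Matrix.vec set)" by (rule card_carrier_vec_bit_ge)
  finally show ?thesis by (simp add: extension_count_def)
qed

section \<open>Fibres of restriction and existence of morphisms\<close>

lemma relmaps_insert_iff:
  assumes X: "finite X" and e: "e \<notin> X" and f: "f \<in> X \<rightarrow>\<^sub>E carrier_vec n"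
  shows "f(e := v) \<in> relmaps n r (insert e X) \<longleftrightarrow>
    f \<in> relmaps n r X \<and> v \<in> extension_values n r X e f"
proof -
  let ?g = "f(e := v)"
  have old: "vsum ?g A = vsum f A" if "A \<subseteq> X" for A
    by (rule vsum_cong) (use that e in auto)
  have new: "vsum ?g (insert e A) = 0 \<longleftrightarrow> coords v = vsum f A"
    "vsum r (insert e A) = 0 \<longleftrightarrow> coords (r e) = vsum r A" if "A \<subseteq> X" for A
  proof -
    have "finite A" "e \<notin> A" using that X e finite_subset by auto
    then show "vsum ?g (insert e A) = 0 \<longleftrightarrow> coords v = vsum f A"
      "vsum r (insert e A) = 0 \<longleftrightarrow> coords (r e) = vsum r A"
      by (simp_all add: vsum_insert old[OF that] bit_fun_add_eq_0_iff)
  qed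
  \<comment> \<open>The power set of \<open>insert e X\<close> splits into the subsets avoiding
    \<open>e\<close>, which constrain only \<open>f\<close>, and those containing \<open>e\<close>,
    which constrain \<open>v\<close>.\<close>
  have "(\<forall>A\<subseteq>insert e X. vsum ?g A = 0 \<longleftrightarrow> vsum r A = 0) \<longleftrightarrow>
     (\<forall>A\<subseteq>X. vsum ?g A = 0 \<longleftrightarrow> vsum r A = 0) \<and>
     (\<forall>A\<subseteq>X. vsum ?g (insert e A) = 0 \<longleftrightarrow> vsum r (insert e A) = 0)"
    unfolding Pow_iff[symmetric] Ball_def[symmetric] Pow_insert ball_Un by simp
  also have "\<dots> \<longleftrightarrow> (\<forall>A\<subseteq>X. vsum f A = 0 \<longleftrightarrow> vsum r A = 0) \<and>
     (\<forall>A\<subseteq>X. coords v = vsum f A \<longleftrightarrow> coords (r e) = vsum r A)"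
    by (simp add: old new)
  finally have *: "(\<forall>A\<subseteq>insert e X. vsum ?g A = 0 \<longleftrightarrow> vsum r A = 0) \<longleftrightarrow>
     (\<forall>A\<subseteq>X. vsum f A = 0 \<longleftrightarrow> vsum r A = 0) \<and>
     (\<forall>A\<subseteq>X. coords v = vsum f A \<longleftrightarrow> coords (r e) = vsum r A)" .
  have "?g \<in> insert e X \<rightarrow>\<^sub>E carrier_vec n \<longleftrightarrow> v \<in> carrier_vec n"
    using f e by (auto simp: PiE_iff extensional_def)
  then show ?thesis using * f by (auto simp: relmaps_def extension_values_def)
qed

text \<open>By extensionality a map on \<open>insert e X\<close> is determined by its restriction
  and its value at \<open>e\<close>, so the admissible values parametrise the fibre.\<close>

lemma relmaps_fibre:
  assumes X: "finite X" and e: "e \<notin> X" and f: "f \<in> relmaps n r X"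
  shows "{g \<in> relmaps n r (insert e X). restrict g X = f} = (\<lambda>v. f(e := v)) ` extension_values n r X e f"
proof (intro equalityI subsetI)
  fix g assume "g \<in> {g \<in> relmaps n r (insert e X). restrict g X = f}"
  then have g: "g \<in> relmaps n r (insert e X)" "restrict g X = f" by auto
  have eq: "g = f(e := g e)"
  proof (rule ext)
    fix x
    show "g x = (f(e := g e)) x"
      using g(1) by (cases "x \<in> X") (auto simp: relmaps_def PiE_def extensional_def simp flip: g(2))
  qed
  have "g e \<in> extension_values n r X e f"
    using g(1) eq relmaps_insert_iff[OF X e, of f n "g e" r] f by (simp add: relmaps_def)
  with eq show "g \<in> (\<lambda>v. f(e := v)) ` extension_values n r X e f" by blast
next
  fix g assume "g \<in> (\<lambda>v. f(e := v)) ` extension_values n r X e f"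
  then obtain v where v: "v \<in> extension_values n r X e f" and g: "g = f(e := v)" by blast
  have fE: "f \<in> X \<rightarrow>\<^sub>E carrier_vec n" using f by (simp add: relmaps_def)
  have "restrict g X = f" using g fE e by (auto simp: fun_eq_iff PiE_def extensional_def)
  then show "g \<in> {g \<in> relmaps n r (insert e X). restrict g X = f}"
    using relmaps_insert_iff[OF X e fE] f v g by simp
qed

lemma restrict_relmaps:
  assumes "g \<in> relmaps n r Y" "X \<subseteq> Y"
  shows "restrict g X \<in> relmaps n r X"
proof -
  have "vsum (restrict g X) A = vsum g A" if "A \<subseteq> X" for A
    by (rule vsum_cong) (use that in auto)
  then show ?thesis using assms by (auto simp: relmaps_def)
qed

text \<open>Existence is greedy: while fewer than \<open>n\<close> elements are placed, the number
  of admissible values for the next one is positive.\<close>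

lemma relmaps_nonempty:
  assumes "finite X" "card X \<le> n"
  shows "relmaps n r X \<noteq> {}"
  using assms
proof (induction X)
  case empty
  then show ?case by (auto simp: relmaps_def)
next
  case (insert e X)
  then obtain f where f: "f \<in> relmaps n r X" by fastforce
  have "extension_values n r X e f \<noteq> {}"
    using card_extension_values[OF insert(1) f, of e] extension_count_pos[OF insert(1), of n r e] insert
    by (metis card.empty card_insert_disjoint less_numeral_extra(3) Suc_le_eq)
  then show ?case using relmaps_fibre[OF insert(1,2) f] by auto
qed

section \<open>Uniform distributions under restriction\<close>

lemma map_pmf_of_set_constant_fibres:
  assumes A: "finite A" "A \<noteq> {}" and B: "f ` A \<subseteq> B"
    and fib: "\<And>y. y \<in> B \<Longrightarrow> card {x \<in> A. f x = y} = c"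
  shows "map_pmf f (pmf_of_set A) = pmf_of_set B"
proof -
  \<comment> \<open>Some fibre is nonempty, so the common size is positive; this in turn makes
    \<open>f\<close> surjective onto \<open>B\<close>.\<close>
  have c: "c > 0"
  proof -
    obtain x where x: "x \<in> A" using A by blast
    then have "c = card {x' \<in> A. f x' = f x}" using fib[of "f x"] B by auto
    moreover have "{x' \<in> A. f x' = f x} \<noteq> {}" using x by blast
    ultimately show ?thesis using A by (simp add: card_gt_0_iff)
  qed
  have img: "f ` A = B"
  proof
    show "B \<subseteq> f ` A"
    proof
      fix y assume "y \<in> B"
      then have "{x \<in> A. f x = y} \<noteq> {}" using fib c by (metis card.empty less_numeral_extra(3))
      then show "y \<in> f ` A" by auto
    qed
  qed (rule B)
  then have finB: "finite B" "B \<noteq> {}" using A by auto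
  have cardA: "card A = c * card B"
  proof -
    have "card A = (\<Sum>y\<in>B. card {x \<in> A. f x = y})"
      using sum.group[OF A(1) finB(1) B, of "\<lambda>_. 1::nat"] by simp
    then show ?thesis using fib by simp
  qed
  show ?thesis
  proof (rule pmf_eqI)
    fix y
    have "pmf (map_pmf f (pmf_of_set A)) y = card (A \<inter> f -` {y}) / card A"
      using A by (simp add: pmf_map measure_pmf_of_set)
    also have "A \<inter> f -` {y} = {x \<in> A. f x = y}" by auto
    also have "card {x \<in> A. f x = y} / card A = indicator B y / card B"
    proof (cases "y \<in> B")
      case True
      then show ?thesis using fib c cardA by simp
    next
      case False
      then have "{x \<in> A. f x = y} = {}" using B by auto
      then show ?thesis using False by (simp only: card.empty) simp
    qed
    finally show "pmf (map_pmf f (pmf_of_set A)) y = pmf (pmf_of_set B) y" using finB by simp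
  qed
qed

text \<open>Every fibre has size \<open>extension_count\<close>, whatever the map below it, so
  restriction preserves uniformity.\<close>

lemma uniform_relmaps_restrict_insert:
  assumes X: "finite X" "e \<notin> X" "card X < n"
  shows "map_pmf (\<lambda>g. restrict g X) (pmf_of_set (relmaps n r (insert e X))) = pmf_of_set (relmaps n r X)"
proof (rule map_pmf_of_set_constant_fibres)
  show "finite (relmaps n r (insert e X))" using X by (simp add: finite_relmaps)
  show "relmaps n r (insert e X) \<noteq> {}" using X by (intro relmaps_nonempty) auto
  show "(\<lambda>g. restrict g X) ` relmaps n r (insert e X) \<subseteq> relmaps n r X"
    using restrict_relmaps by blast
  fix f assume f: "f \<in> relmaps n r X"
  have "inj_on (\<lambda>v. f(e := v)) (extension_values n r X e f)"
    by (rule inj_onI) (metis fun_upd_same)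
  then show "card {g \<in> relmaps n r (insert e X). restrict g X = f} = extension_count n r X e"
    unfolding relmaps_fibre[OF X(1,2) f] card_extension_values[OF X(1) f, symmetric]
    by (rule card_image)
qed

text \<open>Restrictions compose, so the elements of \<open>Y\<close> outside \<open>X\<close> can
  be removed one at a time.\<close>

lemma uniform_relmaps_restrict:
  assumes "finite Y" "card Y \<le> n" "X \<subseteq> Y"
  shows "map_pmf (\<lambda>g. restrict g X) (pmf_of_set (relmaps n r Y)) = pmf_of_set (relmaps n r X)"
  using assms
proof (induction "card Y" arbitrary: Y)
  case 0
  then have "Y = {}" "X = {}" by auto
  moreover have "relmaps n r {} = {\<lambda>_. undefined}" by (auto simp: relmaps_def)
  ultimately show ?case by (simp add: pmf_of_set_singleton)
next
  case (Suc k)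
  show ?case
  proof (cases "X = Y")
    case True
    have "map_pmf (\<lambda>g. restrict g Y) (pmf_of_set (relmaps n r Y)) = map_pmf id (pmf_of_set (relmaps n r Y))"
    proof (rule map_pmf_cong)
      fix g assume "g \<in> set_pmf (pmf_of_set (relmaps n r Y))"
      then have "g \<in> relmaps n r Y"
        using Suc.prems by (simp add: relmaps_nonempty finite_relmaps)
      then show "restrict g Y = id g" by (auto simp: relmaps_def fun_eq_iff PiE_def extensional_def)
    qed simp
    then show ?thesis using True by (simp add: pmf.map_id)
  next
    case False
    then obtain e where e: "e \<in> Y" "e \<notin> X" using Suc.prems by blast
    define Z where "Z = Y - {e}"
    have Z: "Y = insert e Z" "e \<notin> Z" "finite Z" "X \<subseteq> Z" using e Suc.prems by (auto simp: Z_def)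
    have cards: "k = card Z" "card Z < n" using Suc.hyps(2) Suc.prems(2) Z by auto
    have "map_pmf (\<lambda>g. restrict g X) (pmf_of_set (relmaps n r Y)) =
      map_pmf (\<lambda>g. restrict g X) (map_pmf (\<lambda>g. restrict g Z) (pmf_of_set (relmaps n r Y)))"
      using Z(4) by (simp add: map_pmf_comp restrict_restrict Int_absorb1)
    also have "\<dots> = pmf_of_set (relmaps n r X)"
      unfolding Z(1) uniform_relmaps_restrict_insert[OF Z(3,2) cards(2)]
      using Suc.hyps(1)[OF cards(1) Z(3) _ Z(4)] cards by simp
    finally show ?thesis .
  qed
qed

section \<open>The online morphism\<close>

lemma restriction_closed_binary_matroids_upto: "restriction_closed (binary_matroids_upto n)"
  unfolding restriction_closed_def
proof (intro ballI allI impI)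
  fix M :: "'a pre_matroid" and X
  assume M: "M \<in> binary_matroids_upto n" and X: "X \<subseteq> ground M"
  then obtain d r where r: "matroid_morphism M (complete_binary_matroid d) r"
    and card: "card (ground M) \<le> n"
    by (auto simp: binary_matroids_upto_def binary_matroid_def)
  have "finite (ground M)" using r by (simp add: matroid_morphism_def matroid_def)
  then have "card X \<le> n" using X card card_mono le_trans by blast
  then show "restrict_matroid M X \<in> binary_matroids_upto n"
    using binary_morphism_restrict[OF r X]
    by (auto simp: binary_matroids_upto_def binary_matroid_def restrict_matroid_def)
qed

theorem theorem2:
  fixes n :: nat
  assumes "0 < n"
  shows "\<exists>F :: 'a pre_matroid \<Rightarrow> (nat \<Rightarrow> 'a) \<Rightarrow> ('a \<Rightarrow> bit Matrix.vec) pmf.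
    randomized_online_morphism (binary_matroids_upto n) (complete_binary_matroid n) F \<and>
    order_independent (binary_matroids_upto n) F"
proof -
  define Mor where
    "Mor M = {f. matroid_morphism M (complete_binary_matroid n) f}" for M :: "'a pre_matroid"
  \<comment> \<open>The law ignores the ordering, which gives order independence.
    \<open>Mor M\<close> mentions no reference representation, so the choice of \<open>r\<close>
    made below cannot affect consistency.\<close>
  define F :: "'a pre_matroid \<Rightarrow> (nat \<Rightarrow> 'a) \<Rightarrow> ('a \<Rightarrow> bit Matrix.vec) pmf" where
    "F M \<pi> = pmf_of_set (Mor M)" for M \<pi>
  have "set_pmf (F M \<pi>) \<subseteq> Mor M \<and>
      (\<forall>m' < card (ground M). map_pmf (\<lambda>f. restrict f (\<pi> ` {1..m'})) (F M \<pi>) =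
        F (restrict_matroid M (\<pi> ` {1..m'})) (restrict \<pi> {1..m'}))"
    if M: "M \<in> binary_matroids_upto n" and \<pi>: "matroid_ordering M \<pi>" for M \<pi>
  proof -
    obtain d r where r: "matroid_morphism M (complete_binary_matroid d) r"
      and card: "card (ground M) \<le> n"
      using M by (auto simp: binary_matroids_upto_def binary_matroid_def)
    have fin: "finite (ground M)" using r by (simp add: matroid_morphism_def matroid_def)
    have Mor: "Mor M = relmaps n r (ground M)"
      unfolding Mor_def by (rule morphisms_eq_relmaps[OF r])
    \<comment> \<open>Consistency holds for every subset \<open>X\<close> of the ground set, prefix
      or not, and whatever ordering is attached to it.\<close>
    have "map_pmf (\<lambda>f. restrict f X) (F M \<pi>) = F (restrict_matroid M X) \<pi>'"
      if X: "X \<subseteq> ground M" for X \<pi>'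
    proof -
      \<comment> \<open>The restriction of \<open>r\<close> represents the restricted matroid, so
        the same relations describe the morphisms before and after restriction.\<close>
      have "Mor (restrict_matroid M X) = relmaps n (restrict r X) X"
        unfolding Mor_def morphisms_eq_relmaps[OF binary_morphism_restrict[OF r X]]
        by (simp add: restrict_matroid_def)
      also have "\<dots> = relmaps n r X" by (rule relmaps_cong) simp
      finally show ?thesis
        unfolding F_def Mor using uniform_relmaps_restrict[OF fin card X] by simp
    qed
    moreover have "\<pi> ` {1..m'} \<subseteq> ground M" if "m' < card (ground M)" for m'
      using \<pi> that by (auto simp: matroid_ordering_def bij_betw_def)
    moreover have "set_pmf (F M \<pi>) = Mor M"
      unfolding F_def Mor using fin card by (simp add: relmaps_nonempty finite_relmaps)
    ultimately show ?thesis by blast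
  qed
  then have "randomized_online_morphism (binary_matroids_upto n) (complete_binary_matroid n) F"
    unfolding randomized_online_morphism_def Mor_def
    using restriction_closed_binary_matroids_upto by blast
  moreover have "order_independent (binary_matroids_upto n) F"
    by (simp add: order_independent_def F_def)
  ultimately show ?thesis by blast
qed

end
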